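(* Let $\mathcal{X}$ be a Banach space over $\mathbb{K}$ and let $\{\tau_n\}_{n=1}^\infty$ be a sequence in $\mathcal{X}$ such that the map $$\theta_\tau:\ell^1(\mathbb{N})\ni \{a_n\}_{n=1}^\infty\mapsto \theta_\tau\{a_n\}_{n=1}^\infty:=\sum_{n=1}^{\infty}a_n\tau_n\in\mathcal{X}$$ is a well-defined bounded linear surjective operator. Assume that there is a sequence $\{f_n\}_{n=1}^\infty$ in $\mathcal{X}^*$ such that the map $$\theta_f:\mathcal{X}\ni x\mapsto \theta_f x:=\{f_n(x)\}_{n=1}^\infty\in\ell^1(\mathbb{N})$$ is a well-defined bounded linear operator and $$|f_n(\tau_n)|\geq 1,\quad \forall n\in\mathbb{N}.$$ If $x\in\mathcal{X}$ can be written as $x=\theta_\tau c$ for some $c\in\ell^1(\mathbb{N})$ satisfying $$\|c\|_0<\frac{1}{2}\left(1+\frac{1}{\displaystyle\sup_{n,m\in\mathbb{N},\,n\neq m}|f_n(\tau_m)|}\right),$$ then $c$ is the unique solution to the problem $$\underset{d\in\ell^1(\mathbb{N})}{\operatorname{minimize}}\ \|d\|_0\quad\text{subject to}\quad \theta_\tau d=x.$$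
   Context: $\mathbb{K}$ denotes $\mathbb{R}$ or $\mathbb{C}$; $\mathcal{X}$ need not be finite dimensional; $\mathcal{X}^*$ is the (continuous) dual of $\mathcal{X}$; $\mathbb{N}=\{1,2,3,\dots\}$; $\ell^1(\mathbb{N})$ is the space of absolutely summable $\mathbb{K}$-valued sequences with norm $\|\cdot\|_1$. For $d\in\ell^1(\mathbb{N})$, $\|d\|_0\in\{0,1,2,\dots\}\cup\{\infty\}$ is the number of nonzero entries of $d$. The convention $1/0=+\infty$ is used. That $c\in\ell^1(\mathbb{N})$ is the unique solution to the stated minimization problem means: (1) $\theta_\tau c=x$; and (2) if $d\in\ell^1(\mathbb{N})$ satisfies $\theta_\tau d=x$ and $d\neq c$, then $\|d\|_0>\|c\|_0$. *)

theory Defs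
  imports "HOL-Analysis.Analysis" "HOL-Library.Function_Algebras"
begin

text \<open>
  The scalar field is a type of class \<open>real_normed_field\<close>. The instances relevant here are
  \<open>real\<close> and \<open>complex\<close>; by the Gelfand-Mazur theorem there are no others up to isometric isomorphism.

  The class \<open>banach\<close> only provides multiplication by real scalars, so multiplication by the
  scalar field is a separate operation that has to extend it. For scalar type \<open>real\<close> this forces
  \<open>smul = scaleR\<close>.
\<close>

locale banach_space_over = vector_space smul
  for smul :: "'k::real_normed_field \<Rightarrow> 'x::banach \<Rightarrow> 'x" +
  assumes smul_of_real: "smul (of_real r) x = r *\<^sub>R x"
    and norm_smul: "norm (smul a x) = norm a * norm x"

text \<open>Sequences are indexed by \<open>nat\<close>, starting at 0 instead of 1. Their vector space structure
  is pointwise; addition is the one of \<open>Function_Algebras\<close>.\<close>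

definition seq_scale :: "'k::real_normed_field \<Rightarrow> (nat \<Rightarrow> 'k) \<Rightarrow> nat \<Rightarrow> 'k" where
  "seq_scale k a = (\<lambda>n. k * a n)"

definition ell1 :: "(nat \<Rightarrow> 'k::real_normed_field) set" where
  "ell1 = {a. summable (\<lambda>n. norm (a n))}"

definition norm1 :: "(nat \<Rightarrow> 'k::real_normed_field) \<Rightarrow> real" where
  "norm1 a = (\<Sum>n. norm (a n))"

definition norm0 :: "(nat \<Rightarrow> 'k::zero) \<Rightarrow> enat" where
  "norm0 a = (if finite {n. a n \<noteq> 0} then enat (card {n. a n \<noteq> 0}) else \<infinity>)"

text \<open>\<open>U\<close> and \<open>V\<close> are the carriers of the two normed spaces, \<open>sU\<close>, \<open>sV\<close> their scalar
  multiplications and \<open>nU\<close>, \<open>nV\<close> their norms.\<close>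

definition bounded_linear_operator ::
  "'u::ab_group_add set \<Rightarrow> ('k::real_normed_field \<Rightarrow> 'u \<Rightarrow> 'u) \<Rightarrow> ('u \<Rightarrow> real) \<Rightarrow>
   'v::ab_group_add set \<Rightarrow> ('k \<Rightarrow> 'v \<Rightarrow> 'v) \<Rightarrow> ('v \<Rightarrow> real) \<Rightarrow> ('u \<Rightarrow> 'v) \<Rightarrow> bool" where
  "bounded_linear_operator U sU nU V sV nV T \<longleftrightarrow>
     (\<forall>x\<in>U. T x \<in> V) \<and>
     (\<forall>x\<in>U. \<forall>y\<in>U. T (x + y) = T x + T y) \<and>
     (\<forall>k. \<forall>x\<in>U. T (sU k x) = sV k (T x)) \<and>
     (\<exists>B. \<forall>x\<in>U. nV (T x) \<le> B * nU x)"

definition continuous_dual ::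
  "('k::real_normed_field \<Rightarrow> 'x::banach \<Rightarrow> 'x) \<Rightarrow> ('x \<Rightarrow> 'k) set" where
  "continuous_dual smul = {g. bounded_linear_operator UNIV smul norm UNIV (*) norm g}"

definition synthesis ::
  "('k::real_normed_field \<Rightarrow> 'x::banach \<Rightarrow> 'x) \<Rightarrow> (nat \<Rightarrow> 'x) \<Rightarrow> (nat \<Rightarrow> 'k) \<Rightarrow> 'x" where
  "synthesis smul \<tau> a = (\<Sum>n. smul (a n) (\<tau> n))"

definition analysis :: "(nat \<Rightarrow> 'x \<Rightarrow> 'k) \<Rightarrow> 'x \<Rightarrow> nat \<Rightarrow> 'k" where
  "analysis f x = (\<lambda>n. f n x)"

text \<open>\<open>c\<close> is the unique solution of: minimize \<open>norm0 d\<close> over \<open>d \<in> ell1\<close> subject to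
  \<open>T d = x\<close>.\<close>

definition unique_norm0_minimizer ::
  "((nat \<Rightarrow> 'k::real_normed_field) \<Rightarrow> 'x) \<Rightarrow> 'x \<Rightarrow> (nat \<Rightarrow> 'k) \<Rightarrow> bool" where
  "unique_norm0_minimizer T x c \<longleftrightarrow>
     c \<in> ell1 \<and> T c = x \<and> (\<forall>d\<in>ell1. T d = x \<and> d \<noteq> c \<longrightarrow> norm0 d > norm0 c)"

end

theory Submission
  imports Defs
begin

text \<open>
  Two distinct representations of the same vector differ by a nonzero null vector of the synthesis
  operator, and incoherence forbids sparse null vectors. If \<open>b\<close> is a finitely supported sequence
  with \<open>\<Sum>m. b m \<tau> m = 0\<close>, then applying \<open>f n\<close> shows that the matrix with entries
  \<open>f n (\<tau> m)\<close> annihilates \<open>b\<close>. Its diagonal entries have modulus at least 1 and its off-diagonal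
  entries have modulus at most \<open>\<mu>\<close>, so every single entry of \<open>b\<close> carries at most the fraction
  \<open>\<mu> / (1 + \<mu>)\<close> of the total mass of \<open>b\<close>. Hence the mass is spread over at least \<open>1 + 1 / \<mu>\<close>
  indices (lemma \<open>support_of_incoherent_null_vector\<close>).

  If \<open>c \<noteq> d\<close> represent the same vector, the support of \<open>d - c\<close> lies in the union of the two supports,
  so \<open>norm0 c + norm0 d \<ge> 1 + 1 / \<mu> > 2 * norm0 c\<close>, which means \<open>norm0 d > norm0 c\<close>. A
  competitor \<open>d\<close> with infinite support loses trivially, since the hypothesis makes \<open>norm0 c\<close>
  finite; this is why finitely supported null vectors suffice.
\<close>

text \<open>
  The \<open>n\<close>-th equation gives \<open>norm (b n) \<le> \<mu> * (L - norm (b n))\<close>, where \<open>L\<close> is the sum of the norms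
  of the entries of \<open>b\<close>. Summing over \<open>n\<close> and cancelling \<open>L > 0\<close> yields the claim. It is stated
  without division so that it also covers \<open>\<mu> = 0\<close>, where it says that no such \<open>b\<close> exists.
\<close>

lemma support_of_incoherent_null_vector:
  fixes G :: "'i \<Rightarrow> 'i \<Rightarrow> 'k::real_normed_field" and b :: "'i \<Rightarrow> 'k"
  assumes fin: "finite S" and ne: "S \<noteq> {}" and nz: "\<And>m. m \<in> S \<Longrightarrow> b m \<noteq> 0"
    and null: "\<And>n. n \<in> S \<Longrightarrow> (\<Sum>m\<in>S. b m * G n m) = 0"
    and diag: "\<And>n. n \<in> S \<Longrightarrow> 1 \<le> norm (G n n)"
    and off: "\<And>n m. n \<in> S \<Longrightarrow> m \<in> S \<Longrightarrow> n \<noteq> m \<Longrightarrow> norm (G n m) \<le> \<mu>"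
  shows "1 + \<mu> \<le> \<mu> * real (card S)"
proof -
  define L where "L = (\<Sum>m\<in>S. norm (b m))"
  have L_pos: "L > 0"
    unfolding L_def using fin ne nz by (intro sum_pos) auto
  have entry: "(1 + \<mu>) * norm (b n) \<le> \<mu> * L" if n: "n \<in> S" for n
  proof -
    have "b n * G n n = - (\<Sum>m\<in>S - {n}. b m * G n m)"
      using null[OF n] sum.remove[OF fin n, of "\<lambda>m. b m * G n m"]
      by (simp add: eq_neg_iff_add_eq_0)
    then have "norm (b n * G n n) \<le> (\<Sum>m\<in>S - {n}. norm (b m * G n m))"
      by (simp add: norm_sum)
    also have "\<dots> \<le> (\<Sum>m\<in>S - {n}. \<mu> * norm (b m))"
      using off[OF n] by (intro sum_mono) (auto simp: norm_mult mult.commute[of \<mu>] mult_left_mono)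
    also have "\<dots> = \<mu> * (L - norm (b n))"
      using sum.remove[OF fin n, of "\<lambda>m. norm (b m)"]
      by (simp add: L_def sum_distrib_left)
    finally have "norm (b n) * norm (G n n) \<le> \<mu> * (L - norm (b n))"
      by (simp add: norm_mult)
    moreover have "norm (b n) \<le> norm (b n) * norm (G n n)"
      using mult_left_mono[OF diag[OF n], of "norm (b n)"] by simp
    ultimately show ?thesis
      by (simp add: algebra_simps)
  qed
  have "(1 + \<mu>) * L = (\<Sum>n\<in>S. (1 + \<mu>) * norm (b n))"
    by (simp add: L_def sum_distrib_left)
  also have "\<dots> \<le> (\<Sum>n\<in>S. \<mu> * L)"
    by (intro sum_mono entry)
  finally have "(1 + \<mu>) * L \<le> (\<mu> * real (card S)) * L"
    by (simp add: mult_ac)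
  with L_pos show ?thesis
    by simp
qed

lemma continuous_dual_sum:
  assumes "g \<in> continuous_dual smul"
  shows "g (\<Sum>m\<in>S. smul (b m) (t m)) = (\<Sum>m\<in>S. b m * g (t m))"
proof -
  have add: "Modules.additive g" and scale: "\<And>k v. g (smul k v) = k * g v"
    using assms by (auto simp: continuous_dual_def bounded_linear_operator_def Modules.additive_def)
  show ?thesis
    by (simp add: Modules.additive.sum[OF add] scale)
qed

lemma synthesis_finite_support:
  assumes "banach_space_over smul" and "finite {n. a n \<noteq> 0}"
  shows "synthesis smul t a = (\<Sum>n | a n \<noteq> 0. smul (a n) (t n))"
proof -
  interpret banach_space_over smul by fact
  show ?thesis
    unfolding synthesis_def using assms(2) by (intro suminf_finite) auto
qed

lemma synthesis_diff_ell1: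
  assumes space: "banach_space_over smul"
    and summable: "\<And>a. a \<in> ell1 \<Longrightarrow> summable (\<lambda>n. smul (a n) (t n))"
    and "a \<in> ell1" "b \<in> ell1"
  shows "synthesis smul t (\<lambda>n. a n - b n) = synthesis smul t a - synthesis smul t b"
proof -
  interpret banach_space_over smul by fact
  show ?thesis
    unfolding synthesis_def
    by (simp add: scale_left_diff_distrib suminf_diff[OF summable summable] assms(3,4))
qed

text \<open>
  The passage from the extended real sparsity bound to real arithmetic. Infinite coherence forces
  \<open>k = 0\<close>. For zero coherence the bound on \<open>k\<close> is vacuous, because \<open>1 / 0 = \<infinity>\<close>, but the hypothesis
  on \<open>s\<close> would read \<open>1 \<le> 0\<close>, so this case cannot occur.
\<close>

lemma twice_sparsity_less:
  fixes M :: ereal and k s :: nat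
  assumes bound: "ereal (real k) < 1 / 2 * (1 + 1 / M)" and "0 \<le> M" and "0 < s"
    and s: "\<And>\<mu>. M = ereal \<mu> \<Longrightarrow> 1 + \<mu> \<le> \<mu> * real s"
  shows "2 * k < s"
proof (cases M)
  case (real \<mu>)
  have "\<mu> \<noteq> 0"
    using s[OF real] by auto
  with \<open>0 \<le> M\<close> real have pos: "\<mu> > 0"
    by simp
  have "real k < 1 / 2 * (1 + 1 / \<mu>)"
    using bound pos by (simp add: real one_ereal_def numeral_eq_ereal)
  also have "1 + 1 / \<mu> \<le> real s"
    using s[OF real] pos by (simp add: field_simps)
  finally show ?thesis
    by simp
next
  case PInf
  then show ?thesis
    using bound \<open>0 < s\<close> by (simp add: one_ereal_def numeral_eq_ereal)
next
  case MInf
  with \<open>0 \<le> M\<close> show ?thesis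
    by simp
qed

theorem theorem2p7:
  fixes smul :: "'k::real_normed_field \<Rightarrow> 'x::banach \<Rightarrow> 'x"
    and \<tau> :: "nat \<Rightarrow> 'x"
    and f :: "nat \<Rightarrow> 'x \<Rightarrow> 'k"
    and x :: 'x
    and c :: "nat \<Rightarrow> 'k"
  assumes "banach_space_over smul"
    and "\<And>a. a \<in> ell1 \<Longrightarrow> summable (\<lambda>n. smul (a n) (\<tau> n))"
    and "bounded_linear_operator ell1 seq_scale norm1 UNIV smul norm (synthesis smul \<tau>)"
    and "synthesis smul \<tau> ` ell1 = UNIV"
    and "\<And>n. f n \<in> continuous_dual smul"
    and "bounded_linear_operator UNIV smul norm ell1 seq_scale norm1 (analysis f)"
    and "\<And>n. norm (f n (\<tau> n)) \<ge> 1"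
    and "c \<in> ell1"
    and "x = synthesis smul \<tau> c"
    and "ereal_of_enat (norm0 c) <
           1 / 2 * (1 + 1 / (SUP (n, m)\<in>{(n, m). n \<noteq> m}. ereal (norm (f n (\<tau> m)))))"
  shows "unique_norm0_minimizer (synthesis smul \<tau>) x c"
proof -
  define M where "M = (SUP (n, m)\<in>{(n, m). n \<noteq> m}. ereal (norm (f n (\<tau> m))))"
  have bound: "ereal_of_enat (norm0 c) < 1 / 2 * (1 + 1 / M)"
    using assms(10) by (simp only: M_def)
  have M_upper: "ereal (norm (f n (\<tau> m))) \<le> M" if "n \<noteq> m" for n m
    unfolding M_def by (rule SUP_upper2[of "(n, m)"]) (use that in auto)
  have M_nonneg: "0 \<le> M"
    by (rule order_trans[OF _ M_upper[of 0 1]]) auto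
  have fin_c: "finite {n. c n \<noteq> 0}"
    using bound by (auto simp: norm0_def split: if_splits)
  have "norm0 c < norm0 d" if d: "d \<in> ell1" "synthesis smul \<tau> d = x" "d \<noteq> c" for d
  proof (cases "finite {n. d n \<noteq> 0}")
    case False
    with fin_c show ?thesis
      by (simp add: norm0_def)
  next
    case fin_d: True
    define b where "b = (\<lambda>n. d n - c n)"
    define S where "S = {n. b n \<noteq> 0}"
    have S_sub: "S \<subseteq> {n. c n \<noteq> 0} \<union> {n. d n \<noteq> 0}"
      by (auto simp: S_def b_def)
    then have fin_S: "finite S"
      using fin_c fin_d by (meson finite_UnI finite_subset)
    have ne: "S \<noteq> {}"
      using d(3) by (auto simp: S_def b_def)
    have "synthesis smul \<tau> b = 0"
      unfolding b_def using d assms(9)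
      by (simp add: synthesis_diff_ell1[OF assms(1,2) d(1) assms(8)])
    then have null: "(\<Sum>m\<in>S. smul (b m) (\<tau> m)) = 0"
      using synthesis_finite_support[OF assms(1), of b \<tau>] fin_S by (simp add: S_def)
    have annihilated: "(\<Sum>m\<in>S. b m * f n (\<tau> m)) = 0" for n
    proof -
      have "f n 0 = 0"
        using continuous_dual_sum[OF assms(5)[of n], where S = "{}"] by simp
      with null show ?thesis
        using continuous_dual_sum[OF assms(5)[of n], where S = S and b = b and t = \<tau>] by simp
    qed
    have "2 * card {n. c n \<noteq> 0} < card S"
    proof (rule twice_sparsity_less[OF _ M_nonneg])
      show "ereal (real (card {n. c n \<noteq> 0})) < 1 / 2 * (1 + 1 / M)"
        using bound fin_c by (simp add: norm0_def)
      show "0 < card S"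
        using fin_S ne by (simp add: card_gt_0_iff)
      show "1 + \<mu> \<le> \<mu> * real (card S)" if "M = ereal \<mu>" for \<mu>
        using fin_S ne
      proof (rule support_of_incoherent_null_vector[where b = b and G = "\<lambda>n m. f n (\<tau> m)"])
        show "norm (f n (\<tau> m)) \<le> \<mu>" if "n \<noteq> m" for n m
          using M_upper[OF that] \<open>M = ereal \<mu>\<close> by simp
      qed (use annihilated assms(7) in \<open>auto simp: S_def\<close>)
    qed
    also have "card S \<le> card {n. c n \<noteq> 0} + card {n. d n \<noteq> 0}"
      by (rule order_trans[OF card_mono[OF _ S_sub] card_Un_le]) (use fin_c fin_d in simp)
    finally show ?thesis
      using fin_c fin_d by (simp add: norm0_def)
  qed
  with assms(8,9) show ?thesis
    by (auto simp: unique_norm0_minimizer_def)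
qed

end
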